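(* Let $\mathbf{M}$ be the $v\times b$ incidence matrix of a symmetric $(v,b,k,r,\lambda)$-BIBD (so $v=b$ and $r=k$), and let $\mathbf{E}=\mathbf{M}$ be the encoding matrix of the resulting gradient code, with parameters $N=b$, $K=v$, $L=k$, $R=r$. Let $0\le S<N$ be an integer. 1. For any set (of non-stragglers) $\mathcal{F}\subseteq[N]$ of size $N-S$, the vector $$\mathbf{v}_{\mathrm{opt}}=\left(\frac{L}{L+\lambda(N-S-1)}\right)\mathbf{1}_{N-S}$$ is an optimal decoding vector, i.e. it minimizes $\|\mathbf{E}_{\mathcal{F}}\mathbf{v}-\mathbf{1}_K\|_2^2$ over $\mathbf{v}\in\mathbb{R}^{N-S}$. 2. The worst-case approximation error for $S$ stragglers is $$\mathrm{err}_S(\mathbf{E})=K-\frac{L^2(N-S)}{L+\lambda(N-S-1)}.$$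
   Context: A design is a pair $(X,\mathcal{A})$ where $X=\{x_1,\dots,x_v\}$ is a finite set of points and $\mathcal{A}=\{A_1,\dots,A_b\}$ is a collection of nonempty subsets of $X$ called blocks. Its incidence matrix is the $v\times b$ binary matrix $\mathbf{M}$ with $\mathbf{M}_{i,j}=1$ if $x_i\in A_j$ and $0$ otherwise. A $(v,b,k,r,\lambda)$-balanced incomplete block design (BIBD) is a design with $v$ points and $b$ blocks, each block of size $k$, such that every point is contained in exactly $r$ blocks and any pair of distinct points is contained in exactly $\lambda$ blocks. A BIBD is symmetric if $v=b$ (equivalently $r=k$). A gradient code with $N$ workers and $K$ data parts is given by an encoding matrix $\mathbf{E}\in\mathbb{R}^{K\times N}$; $L$ is the maximum number of nonzero entries in a column, $R$ the minimum number of nonzero entries in a row. For $\mathcal{F}\subseteq[N]=\{1,\dots,N\}$, $\mathbf{E}_{\mathcal{F}}$ is the submatrix of the columns indexed by $\mathcal{F}$; $\mathbf{1}_m$ is the $m\times1$ all-ones vector. For $|\mathcal{F}|=N-S$, the approximation error is $\mathrm{err}_{\mathcal{F}}(\mathbf{E})=\min_{\mathbf{v}\in\mathbb{R}^{N-S}}\|\mathbf{E}_{\mathcal{F}}\mathbf{v}-\mathbf{1}_K\|_2^2$, a minimizer is called an optimal decoding vector, and the worst-case approximation error for $S<N$ stragglers is $\mathrm{err}_S(\mathbf{E})=\max_{\mathcal{F}\subseteq[N],\,|\mathcal{F}|=N-S}\mathrm{err}_{\mathcal{F}}(\mathbf{E})$. *)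

theory Defs
  imports "HOL-Analysis.L2_Norm" "Jordan_Normal_Form.DL_Submatrix"
begin

(* A design with a fixed numbering of its points and blocks. Points are pairwise distinct;
   the blocks form a collection, so the same subset may occur several times in As. *)
definition design :: "'a list \<Rightarrow> 'a set list \<Rightarrow> bool" where
  "design xs As \<longleftrightarrow> distinct xs \<and> (\<forall>A \<in> set As. A \<noteq> {} \<and> A \<subseteq> set xs)"

(* filter keeps repetitions, so blocks are counted with multiplicity. *)
definition bibd ::
  "nat \<Rightarrow> nat \<Rightarrow> nat \<Rightarrow> nat \<Rightarrow> nat \<Rightarrow> 'a list \<Rightarrow> 'a set list \<Rightarrow> bool" where
  "bibd v b k r lam xs As \<longleftrightarrow>
     design xs As \<and> length xs = v \<and> length As = b \<and>
     (\<forall>A \<in> set As. card A = k) \<and>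
     (\<forall>x \<in> set xs. length (filter (\<lambda>A. x \<in> A) As) = r) \<and>
     (\<forall>x \<in> set xs. \<forall>y \<in> set xs. x \<noteq> y \<longrightarrow> length (filter (\<lambda>A. x \<in> A \<and> y \<in> A) As) = lam)"

definition symmetric_bibd ::
  "nat \<Rightarrow> nat \<Rightarrow> nat \<Rightarrow> nat \<Rightarrow> nat \<Rightarrow> 'a list \<Rightarrow> 'a set list \<Rightarrow> bool" where
  "symmetric_bibd v b k r lam xs As \<longleftrightarrow> bibd v b k r lam xs As \<and> v = b"

definition incidence_mat :: "'a list \<Rightarrow> 'a set list \<Rightarrow> 'b :: zero_neq_one mat" where
  "incidence_mat xs As =
     mat (length xs) (length As) (\<lambda>(i, j). if xs ! i \<in> As ! j then 1 else 0)"

(* A gradient code is given by its encoding matrix: rows are data parts, columns are workers.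
   Indices start at 0, so the set of workers is {..<num_workers E}. *)
definition num_workers :: "real mat \<Rightarrow> nat" where
  "num_workers E = dim_col E"

definition num_parts :: "real mat \<Rightarrow> nat" where
  "num_parts E = dim_row E"

definition max_col_weight :: "real mat \<Rightarrow> nat" where
  "max_col_weight E =
     Max ((\<lambda>j. card {i. i < dim_row E \<and> E $$ (i, j) \<noteq> 0}) ` {..<dim_col E})"

definition min_row_weight :: "real mat \<Rightarrow> nat" where
  "min_row_weight E =
     Min ((\<lambda>i. card {j. j < dim_col E \<and> E $$ (i, j) \<noteq> 0}) ` {..<dim_row E})"

definition all_ones :: "nat \<Rightarrow> real vec" where
  "all_ones m = vec m (\<lambda>_. 1)"

definition l2_norm :: "real vec \<Rightarrow> real" where
  "l2_norm w = L2_set (\<lambda>i. w $ i) {..<dim_vec w}"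

definition decoding_error :: "real mat \<Rightarrow> nat set \<Rightarrow> real vec \<Rightarrow> real" where
  "decoding_error E F w =
     (l2_norm (submatrix E UNIV F *\<^sub>v w - all_ones (num_parts E)))\<^sup>2"

definition optimal_decoding_vector :: "real mat \<Rightarrow> nat set \<Rightarrow> real vec \<Rightarrow> bool" where
  "optimal_decoding_vector E F w \<longleftrightarrow>
     w \<in> carrier_vec (card F) \<and>
     (\<forall>u \<in> carrier_vec (card F). decoding_error E F w \<le> decoding_error E F u)"

(* LEAST denotes the minimum of the set of attained values; a linear least squares
   problem always has a minimizer, so this minimum exists. *)
definition err_set :: "real mat \<Rightarrow> nat set \<Rightarrow> real" where
  "err_set E F = (LEAST e. e \<in> decoding_error E F ` carrier_vec (card F))"

definition err_worst :: "real mat \<Rightarrow> nat \<Rightarrow> real" where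
  "err_worst E S =
     Max (err_set E ` {F. F \<subseteq> {..<num_workers E} \<and> card F = num_workers E - S})"

end

theory Submission
  imports Defs
begin

text \<open>In a symmetric BIBD any two distinct blocks meet in exactly \<open>\<lambda>\<close> points: for a fixed block
\<open>A\<close>, double counting evaluates \<open>\<Sum>\<^sub>B |A \<inter> B|\<close> and \<open>\<Sum>\<^sub>B |A \<inter> B|\<^sup>2\<close>, and these values force
\<open>\<Sum>\<^sub>B (|A \<inter> B| - \<lambda>)\<^sup>2 = (|A| - \<lambda>)\<^sup>2\<close>, so the
terms with \<open>B \<noteq> A\<close> vanish. Hence the columns of any submatrix \<open>E\<^sub>F\<close> have inner products \<open>L\<close>
or \<open>\<lambda>\<close>, so the constant vector of the statement solves the normal equations, and the error does
not depend on \<open>F\<close>.\<close>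

lemma symmetric_design_dual:
  fixes M :: "nat \<Rightarrow> nat \<Rightarrow> real"
  assumes idem: "\<And>i j. M i j * M i j = M i j"
    and row: "\<And>i. i < n \<Longrightarrow> (\<Sum>j<n. M i j) = r"
    and col: "\<And>j. j < n \<Longrightarrow> (\<Sum>i<n. M i j) = k"
    and pair: "\<And>i i'. i < n \<Longrightarrow> i' < n \<Longrightarrow> i \<noteq> i' \<Longrightarrow> (\<Sum>j<n. M i j * M i' j) = lam"
    and j: "j < n" and j': "j' < n" and "j \<noteq> j'"
  shows "(\<Sum>i<n. M i j * M i j') = lam"
proof -
  have "n > 0" using j by simp
  \<comment> \<open>All incidences, counted by rows and by columns.\<close>
  have "(\<Sum>i<n. \<Sum>j<n. M i j) = (\<Sum>j<n. \<Sum>i<n. M i j)" by (rule sum.swap)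
  then have "real n * r = real n * k" using row col by simp
  then have rk: "r = k" using \<open>n > 0\<close> by simp
  have pair': "(\<Sum>j<n. M i j * M i' j) = lam + (if i' = i then r - lam else 0)"
    if "i < n" "i' < n" for i i'
    using that pair[of i i'] row[of i] by (auto simp: idem)
  \<comment> \<open>Summing the inner products of row 0 with every row, itself included, gives the
    classical relation \<open>lam * (n - 1) = k * (k - 1)\<close>, here as
    \<open>count\<close>.\<close>
  have "(\<Sum>i'<n. \<Sum>j<n. M 0 j * M i' j) = (\<Sum>j<n. M 0 j * (\<Sum>i'<n. M i' j))"
    unfolding sum_distrib_left by (rule sum.swap)
  also have "\<dots> = k * k"
    using \<open>n > 0\<close> by (simp add: col row rk flip: sum_distrib_right)
  finally have count: "real n * lam + (k - lam) = k * k"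
    using \<open>n > 0\<close> by (simp add: pair' rk sum.distrib)
  \<comment> \<open>\<open>count\<close> times \<open>lam\<close>; it eliminates \<open>n\<close>
    from the expanded sum of squares below.\<close>
  have lam2: "real n * lam\<^sup>2 = lam * (k * k - (k - lam))"
    unfolding count[symmetric] by (simp add: power2_eq_square)
  \<comment> \<open>For an incidence matrix, \<open>P l\<close> is the number of points common to
    blocks \<open>j\<close> and \<open>l\<close>.\<close>
  define P where "P l = (\<Sum>i<n. M i j * M i l)" for l
  have "(\<Sum>l<n. P l) = (\<Sum>i<n. M i j * (\<Sum>l<n. M i l))"
    unfolding P_def sum_distrib_left by (rule sum.swap)
  also have "\<dots> = k * k"
    using j by (simp add: col row rk flip: sum_distrib_right)
  finally have P1: "(\<Sum>l<n. P l) = k * k" .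
  \<comment> \<open>Squaring produces pairs of rows \<open>i\<close>, \<open>i'\<close>. Moving the
    sum over \<open>l\<close> innermost turns it into the row inner products known from
    \<open>pair'\<close>.\<close>
  have "(\<Sum>l<n. (P l)\<^sup>2) = (\<Sum>l<n. \<Sum>i<n. \<Sum>i'<n. M i j * M i' j * (M i l * M i' l))"
    unfolding P_def power2_eq_square sum_product by (simp add: mult_ac)
  also have "\<dots> = (\<Sum>i<n. \<Sum>i'<n. \<Sum>l<n. M i j * M i' j * (M i l * M i' l))"
    by (subst sum.swap, rule sum.cong[OF refl], rule sum.swap)
  also have "\<dots> = (\<Sum>i<n. \<Sum>i'<n. M i j * M i' j * (lam + (if i' = i then r - lam else 0)))"
    by (simp add: pair' flip: sum_distrib_left)
  also have "\<dots> = (\<Sum>i<n. \<Sum>i'<n. lam * (M i j * M i' j) +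
      (if i' = i then (k - lam) * (M i j * M i' j) else 0))"
    by (intro sum.cong refl) (auto simp: rk algebra_simps)
  also have "\<dots> = lam * (k * k) + (k - lam) * k"
    using j by (simp add: sum.distrib idem col flip: sum_distrib_left sum_distrib_right)
  finally have P2: "(\<Sum>l<n. (P l)\<^sup>2) = lam * (k * k) + (k - lam) * k" .
  have "(\<Sum>l<n. (P l - lam)\<^sup>2) = (\<Sum>l<n. (P l)\<^sup>2) - 2 * lam * (\<Sum>l<n. P l) + real n * lam\<^sup>2"
    by (simp add: power2_diff sum.distrib sum_subtractf sum_distrib_left mult_ac)
  also have "\<dots> = (k - lam)\<^sup>2"
    unfolding P1 P2 lam2 by (simp add: power2_eq_square algebra_simps)
  \<comment> \<open>With this substitution the whole sum equals its own term at
    \<open>l = j\<close>, so the remaining nonnegative terms add up to 0.\<close>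
  also have "k = P j"
    unfolding P_def using j by (simp add: idem col)
  finally have "(\<Sum>l<n. (P l - lam)\<^sup>2) = (P j - lam)\<^sup>2" .
  then have "(\<Sum>l\<in>{..<n} - {j}. (P l - lam)\<^sup>2) = 0"
    using j by (simp add: sum_diff1)
  then have "P j' = lam"
    using j' \<open>j \<noteq> j'\<close> by (subst (asm) sum_nonneg_eq_0_iff) auto
  then show ?thesis unfolding P_def .
qed

lemma l2_norm_square: "(l2_norm w)\<^sup>2 = w \<bullet> w"
  by (simp add: l2_norm_def L2_set_def scalar_prod_def sum_nonneg power2_eq_square
      lessThan_atLeast0)

text \<open>Pythagoras: the normal equations make the residual \<open>p\<close> at \<open>w\<close>
  orthogonal to the column space, and moving to \<open>u\<close> adds to \<open>p\<close> the vector
  \<open>A *\<^sub>v (u - w)\<close> of that space.\<close>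

lemma l2_norm_minimal:
  assumes A: "A \<in> carrier_mat m n" and w: "w \<in> carrier_vec n" and u: "u \<in> carrier_vec n"
    and y: "y \<in> carrier_vec m"
    and normal: "A\<^sup>T *\<^sub>v (A *\<^sub>v w - y) = 0\<^sub>v n"
  shows "(l2_norm (A *\<^sub>v w - y))\<^sup>2 \<le> (l2_norm (A *\<^sub>v u - y))\<^sup>2"
proof -
  define p where "p = A *\<^sub>v w - y"
  define q where "q = A *\<^sub>v (u - w)"
  have p: "p \<in> carrier_vec m" and q: "q \<in> carrier_vec m"
    using A w u y by (auto simp: p_def q_def)
  have "p \<bullet> q = (A\<^sup>T *\<^sub>v p) \<bullet> (u - w)"
    unfolding q_def by (rule transpose_vec_mult_scalar[OF A _ p, symmetric]) (use u w in auto)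
  then have pq: "p \<bullet> q = 0"
    using u w normal by (simp add: p_def)
  have "A *\<^sub>v u - y = p + q"
    using A w u y by (auto simp: p_def q_def mult_minus_distrib_mat_vec)
  then have "(l2_norm (A *\<^sub>v u - y))\<^sup>2 = p \<bullet> p + q \<bullet> q"
    using p q pq comm_scalar_prod[OF p q]
    by (simp add: l2_norm_square add_scalar_prod_distrib[of _ m] scalar_prod_add_distrib[of _ m])
  moreover have "q \<bullet> q \<ge> 0"
    unfolding l2_norm_square[symmetric] by simp
  ultimately show ?thesis
    by (simp add: l2_norm_square p_def)
qed

text \<open>The Gram matrix is \<open>k - lam\<close> times the identity plus \<open>lam\<close>
  times the all-ones matrix. The constant vector is thus an eigenvector with eigenvalue
  \<open>k + lam * (n - 1)\<close>, and dividing \<open>k\<close> by this eigenvalue gives the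
  coefficient in \<open>w\<close>.\<close>

lemma equiangular_columns_least_squares:
  assumes A: "A \<in> carrier_mat m n"
    and ones: "\<And>j. j < n \<Longrightarrow> col A j \<bullet> all_ones m = k"
    and diag: "\<And>j. j < n \<Longrightarrow> col A j \<bullet> col A j = k"
    and off: "\<And>j j'. j < n \<Longrightarrow> j' < n \<Longrightarrow> j \<noteq> j' \<Longrightarrow> col A j \<bullet> col A j' = lam"
    and nz: "k + lam * (real n - 1) \<noteq> 0"
    and w_def: "w = (k / (k + lam * (real n - 1))) \<cdot>\<^sub>v all_ones n"
  shows "A\<^sup>T *\<^sub>v (A *\<^sub>v w - all_ones m) = 0\<^sub>v n" (is ?normal)
    and "(l2_norm (A *\<^sub>v w - all_ones m))\<^sup>2 = real m - k\<^sup>2 * real n / (k + lam * (real n - 1))"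
      (is ?error)
proof -
  define c where "c = k / (k + lam * (real n - 1))"
  have w: "w \<in> carrier_vec n" and y: "all_ones m \<in> carrier_vec m"
    by (auto simp: w_def all_ones_def)
  have w_vec: "w = vec n (\<lambda>_. c)"
    by (auto simp: w_def c_def all_ones_def)
  have Aw: "A *\<^sub>v w \<in> carrier_vec m" using A w by auto
  have gram: "row (A\<^sup>T * A) j \<bullet> w = k" if j: "j < n" for j
  proof -
    have "row (A\<^sup>T * A) j \<bullet> w = (\<Sum>l<n. (col A j \<bullet> col A l) * c)"
      using A j by (subst scalar_prod_def) (simp add: w_vec lessThan_atLeast0)
    also have "\<dots> = (\<Sum>l<n. lam * c + (if l = j then (k - lam) * c else 0))"
      using j by (intro sum.cong refl) (auto simp: diag off algebra_simps)
    also have "\<dots> = (k + lam * (real n - 1)) * c"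
      using j by (simp add: sum.distrib algebra_simps)
    also have "\<dots> = k" using nz by (simp add: c_def)
    finally show ?thesis .
  qed
  have AT: "A\<^sup>T \<in> carrier_mat n m" using A by simp
  have "A\<^sup>T *\<^sub>v (A *\<^sub>v w - all_ones m) = (A\<^sup>T * A) *\<^sub>v w - A\<^sup>T *\<^sub>v all_ones m"
    using mult_minus_distrib_mat_vec[OF AT Aw y] assoc_mult_mat_vec[OF AT A w] by simp
  also have "\<dots> = 0\<^sub>v n"
    using A gram ones by (intro eq_vecI) (auto simp del: row_mult)
  finally show normal: ?normal .
  define p where "p = A *\<^sub>v w - all_ones m"
  have p: "p \<in> carrier_vec m" using Aw y by (simp add: p_def)
  \<comment> \<open>The normal equations, read as orthogonality of the residual to the column
    space.\<close>
  have orth: "(A *\<^sub>v z) \<bullet> p = 0" if "z \<in> carrier_vec n" for z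
    using transpose_vec_mult_scalar[OF A that p] normal that A
      comm_scalar_prod[OF mult_mat_vec_carrier[OF A that] p] by (simp add: p_def)
  have "w \<bullet> (A\<^sup>T *\<^sub>v all_ones m) = c * k * real n"
    using A ones by (subst scalar_prod_def) (simp add: w_vec)
  moreover have "w \<bullet> (A\<^sup>T *\<^sub>v all_ones m) = (A *\<^sub>v w) \<bullet> all_ones m"
    using transpose_vec_mult_scalar[OF A w y] comm_scalar_prod[OF w, of "A\<^sup>T *\<^sub>v all_ones m"]
      comm_scalar_prod[OF Aw y] AT y by simp
  ultimately have Aw1: "(A *\<^sub>v w) \<bullet> all_ones m = c * k * real n" by simp
  have yy: "all_ones m \<bullet> all_ones m = real m"
    by (simp add: scalar_prod_def all_ones_def)
  \<comment> \<open>Of the two parts of the left factor \<open>p\<close>, the one in the column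
    space contributes 0, so only an inner product with the ones vector remains.\<close>
  have "p \<bullet> p = - (all_ones m \<bullet> p)"
    using minus_scalar_prod_distrib[OF Aw y p] orth[OF w] by (simp add: p_def)
  also have "all_ones m \<bullet> p = c * k * real n - real m"
    using scalar_prod_minus_distrib[OF y Aw y] comm_scalar_prod[OF Aw y] Aw1 yy
    by (simp add: p_def)
  finally show ?error
    unfolding l2_norm_square by (simp add: p_def c_def power2_eq_square)
qed

theorem theorem1:
  fixes xs :: "'a list" and As :: "'a set list"
    and v b k r lam N K L R S :: nat and E :: "real mat"
  assumes "symmetric_bibd v b k r lam xs As"
    and "E = incidence_mat xs As"
    and "N = num_workers E" and "K = num_parts E"
    and "L = max_col_weight E" and "R = min_row_weight E"
    and "S < N"
  shows "(N = b \<and> K = v \<and> L = k \<and> R = r) \<and>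
    (\<forall>F. F \<subseteq> {..<N} \<and> card F = N - S \<longrightarrow>
       optimal_decoding_vector E F
         ((real L / (real L + real lam * (real N - real S - 1))) \<cdot>\<^sub>v all_ones (N - S))) \<and>
    err_worst E S =
      real K - (real L)\<^sup>2 * (real N - real S) / (real L + real lam * (real N - real S - 1))"
proof -
  define M :: "nat \<Rightarrow> nat \<Rightarrow> real" where "M i j = (if xs ! i \<in> As ! j then 1 else 0)" for i j
  have "distinct xs" and v: "length xs = v" and b: "length As = v" "b = v"
    and blocks: "\<And>j. j < v \<Longrightarrow> As ! j \<noteq> {} \<and> As ! j \<subseteq> set xs \<and> card (As ! j) = k"
    and rows: "\<And>i. i < v \<Longrightarrow> length (filter (\<lambda>A. xs ! i \<in> A) As) = r"
    and pairs: "\<And>i i'. i < v \<Longrightarrow> i' < v \<Longrightarrow> i \<noteq> i' \<Longrightarrow>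
      length (filter (\<lambda>A. xs ! i \<in> A \<and> xs ! i' \<in> A) As) = lam"
    using assms(1) unfolding symmetric_bibd_def bibd_def design_def
    by (auto simp: nth_eq_iff_index_eq)
  have E: "E \<in> carrier_mat v v" and E_index: "\<And>i j. i < v \<Longrightarrow> j < v \<Longrightarrow> E $$ (i, j) = M i j"
    using assms(2) v b by (auto simp: incidence_mat_def M_def)
  have N: "N = v" and K: "K = v"
    using assms(3,4) E by (auto simp: num_workers_def num_parts_def)
  have "v > 0" using \<open>S < N\<close> N by simp
  have col_card: "card {i. i < v \<and> xs ! i \<in> As ! j} = k" if "j < v" for j
  proof -
    \<comment> \<open>The numbering of the points is injective, so row indices can be counted
      instead of points.\<close>
    have "(\<lambda>i. xs ! i) ` {i. i < v \<and> xs ! i \<in> As ! j} = As ! j"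
      using blocks[OF that] v by (auto simp: in_set_conv_nth subset_iff image_iff)
    moreover have "inj_on (\<lambda>i. xs ! i) {i. i < v \<and> xs ! i \<in> As ! j}"
      using \<open>distinct xs\<close> v by (intro inj_on_nth) auto
    ultimately show ?thesis
      using card_image blocks[OF that] by metis
  qed
  have row_card: "card {j. j < v \<and> xs ! i \<in> As ! j} = r" if "i < v" for i
    using rows[OF that] b by (simp add: length_filter_conv_card)
  have "{i. i < dim_row E \<and> E $$ (i, j) \<noteq> 0} = {i. i < v \<and> xs ! i \<in> As ! j}" if "j < v" for j
    using E E_index that by (auto simp: M_def split: if_splits)
  \<comment> \<open>Every column has weight \<open>k\<close>, so the maximum ranges over a
    singleton; \<open>v > 0\<close> ensures that there is a column at all.\<close>
  then have "(\<lambda>j. card {i. i < dim_row E \<and> E $$ (i, j) \<noteq> 0}) ` {..<dim_col E} = {k}"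
    using E col_card \<open>v > 0\<close> by (auto simp: image_iff)
  then have L: "L = k" using assms(5) by (simp add: max_col_weight_def)
  have "{j. j < dim_col E \<and> E $$ (i, j) \<noteq> 0} = {j. j < v \<and> xs ! i \<in> As ! j}" if "i < v" for i
    using E E_index that by (auto simp: M_def split: if_splits)
  then have "(\<lambda>i. card {j. j < dim_col E \<and> E $$ (i, j) \<noteq> 0}) ` {..<dim_row E} = {r}"
    using E row_card \<open>v > 0\<close> by (auto simp: image_iff)
  then have R: "R = r" using assms(6) by (simp add: min_row_weight_def)
  have "k > 0"
    using blocks[OF \<open>v > 0\<close>] finite_subset[of "As ! 0" "set xs"] by (auto simp: card_gt_0_iff)

  have sum_ind: "(\<Sum>i<v. if P i then 1 else 0 :: real) = real (card {i. i < v \<and> P i})" for P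
    by (simp add: sum.If_cases Int_def)
  have idem: "M i j * M i j = M i j" for i j by (simp add: M_def)
  have col_sum: "(\<Sum>i<v. M i j) = real k" if "j < v" for j
    using col_card[OF that] by (simp add: M_def sum_ind)
  have row_sum: "(\<Sum>j<v. M i j) = real r" if "i < v" for i
    using row_card[OF that] by (simp add: M_def sum_ind)
  have pair_sum: "(\<Sum>j<v. M i j * M i' j) = real lam" if "i < v" "i' < v" "i \<noteq> i'" for i i'
  proof -
    have "M i j * M i' j = (if xs ! i \<in> As ! j \<and> xs ! i' \<in> As ! j then 1 else 0)" for j
      by (simp add: M_def)
    then show ?thesis
      using pairs[OF that] b by (simp add: sum_ind length_filter_conv_card)
  qed
  \<comment> \<open>Distinct blocks meet in \<open>lam\<close> points.\<close>
  note dual = symmetric_design_dual[where M = M, OF idem row_sum col_sum pair_sum]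

  define n where "n = N - S"
  have n: "n > 0" "real n = real N - real S" using \<open>S < N\<close> by (auto simp: n_def)
  define w where "w = (real k / (real k + real lam * (real n - 1))) \<cdot>\<^sub>v all_ones n"
  define err where "err = real v - (real k)\<^sup>2 * real n / (real k + real lam * (real n - 1))"
  have main: "optimal_decoding_vector E F w \<and> decoding_error E F w = err"
    if F: "F \<subseteq> {..<N}" "card F = n" for F
  proof -
    define A where "A = submatrix E UNIV F"
    have Fset: "{j. j < v \<and> j \<in> F} = F" using F N by auto
    have pick: "pick F j < v" "pick F j \<in> F" if "j < n" for j
      using pick_in_set_le[of j F] that F N by auto
    have A: "A \<in> carrier_mat v n"
      using E F Fset by (auto simp: A_def submatrix_def)
    have colA: "col A j = vec v (\<lambda>i. M i (pick F j))" if "j < n" for j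
      using A E F Fset that pick[OF that] E_index
      by (intro eq_vecI) (auto simp: A_def submatrix_def pick_UNIV)
    \<comment> \<open>\<open>pick F\<close> enumerates \<open>F\<close> increasingly, so distinct
      columns of \<open>A\<close> come from distinct blocks and \<open>dual\<close> applies to
      them.\<close>
    have inj: "pick F j \<noteq> pick F j'" if "j < n" "j' < n" "j \<noteq> j'" for j j'
      using that pick_mono_le[of j' F j] pick_mono_le[of j F j'] F N Fset
      by (cases j j' rule: linorder_cases) auto
    \<comment> \<open>Here \<open>S < N\<close> enters through \<open>n \<ge> 1\<close>; with
      nonempty blocks it makes the denominator positive.\<close>
    have "real lam * (real n - 1) \<ge> 0" using n(1) by simp
    then have nz: "real k + real lam * (real n - 1) \<noteq> 0" using \<open>k > 0\<close> by linarith
    have w: "w \<in> carrier_vec n" by (simp add: w_def all_ones_def)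
    have y: "all_ones v \<in> carrier_vec v" by (simp add: all_ones_def)
    have ones: "col A j \<bullet> all_ones v = real k" if "j < n" for j
      using that pick col_sum by (simp add: colA scalar_prod_def all_ones_def flip: lessThan_atLeast0)
    have diag: "col A j \<bullet> col A j = real k" if "j < n" for j
      using that pick col_sum by (simp add: colA scalar_prod_def idem flip: lessThan_atLeast0)
    have off: "col A j \<bullet> col A j' = real lam" if "j < n" "j' < n" "j \<noteq> j'" for j j'
      using that pick inj dual by (simp add: colA scalar_prod_def flip: lessThan_atLeast0)
    note ls = equiangular_columns_least_squares[OF A ones diag off nz w_def]
    have de: "decoding_error E F u = (l2_norm (A *\<^sub>v u - all_ones v))\<^sup>2" for u
      using K assms(4) by (simp add: decoding_error_def A_def)
    show ?thesis
      unfolding optimal_decoding_vector_def de err_def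
      using ls w F l2_norm_minimal[OF A w _ y] by blast
  qed
  \<comment> \<open>\<open>err\<close> is attained at \<open>w\<close> and bounds all other errors
    from below, so it is the \<open>LEAST\<close> value. As it is the same for every
    \<open>F\<close>, the worst case is a maximum over a singleton.\<close>
  have "err_set E F = err" if "F \<subseteq> {..<N}" "card F = n" for F
    unfolding err_set_def
    using main[OF that] by (intro Least_equality) (auto simp: optimal_decoding_vector_def)
  moreover have "{F. F \<subseteq> {..<N} \<and> card F = n} \<noteq> {}"
    by (auto intro!: exI[of _ "{..<n}"] simp: n_def)
  ultimately have "err_set E ` {F. F \<subseteq> {..<N} \<and> card F = n} = {err}"
    by auto
  then have "err_worst E S = err"
    using assms(3) by (simp add: err_worst_def n_def)
  then show ?thesis
    using main N K L R b n by (simp add: w_def err_def n_def)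
qed

end
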